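(* Let $N$ and $M$ be positive integers larger than unity. Consider the system of $N$ first-order ordinary differential equations with homogeneous polynomials of degree $M$ on their right-hand sides $$\dot z_n(t)=\sum_{\substack{m_1,\dots,m_N\ge 0\\ m_1+\cdots+m_N=M}} c_{n m_1 m_2\cdots m_N}\,[z_1(t)]^{m_1}[z_2(t)]^{m_2}\cdots[z_N(t)]^{m_N},\qquad n=1,2,\dots,N.$$ This system features the special solution $$z_n(t)=z_n(0)\,(1+Kt)^{1/(1-M)},\qquad n=1,2,\dots,N,$$ provided there hold the following $N$ explicit algebraic constraints on the a priori arbitrary parameter $K$, the coefficients $c_{n m_1 m_2\cdots m_N}$ and the $N$ initial data $z_n(0)$: $$K\,z_n(0)=(1-M)\left[\sum_{\substack{m_1,\dots,m_N\ge 0\\ m_1+\cdots+m_N=M}} c_{n m_1 m_2\cdots m_N}\,[z_1(0)]^{m_1}[z_2(0)]^{m_2}\cdots[z_N(0)]^{m_N}\right],\qquad n=1,2,\dots,N.$$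
   Context: The sums run over all nonnegative integer values of the $N$ indices $m_1,\dots,m_N$ subject to $m_1+\cdots+m_N=M$. The independent variable $t$ can be considered as playing the role of "time", taking all nonnegative real values (it may also be formally replaced by a complex variable). A superimposed dot indicates differentiation with respect to $t$. The coefficients $c_{n m_1 m_2\cdots m_N}$ are $t$-independent parameters, the dependent variables $z_n\equiv z_n(t)$ are functions of $t$, and $z_n(0)$ are their initial data. The coefficients and the dependent variables may be restricted to be real, or may be taken to be complex. *)

theory Defs
  imports "HOL-Analysis.Analysis"
begin

text \<open>The index set \<open>{1, \<dots>, N}\<close> is rendered as a finite type \<open>'n\<close> with \<open>N = CARD('n)\<close>.\<close>

definition multi_indices :: "nat \<Rightarrow> ('n::finite \<Rightarrow> nat) set" where
  "multi_indices M = {m. (\<Sum>i\<in>UNIV. m i) = M}"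

text \<open>Finiteness rules out the convention that a sum over an infinite set is \<open>0\<close>.\<close>

lemma finite_multi_indices: "finite (multi_indices M :: ('n::finite \<Rightarrow> nat) set)"
proof (rule finite_subset)
  show "(multi_indices M :: ('n \<Rightarrow> nat) set) \<subseteq> (\<Pi>\<^sub>E i\<in>UNIV. {..M})"
    unfolding multi_indices_def by (auto simp: PiE_def Pi_def intro: member_le_sum)
qed (simp add: finite_PiE)

definition hom_rhs ::
  "nat \<Rightarrow> ('n::finite \<Rightarrow> ('n \<Rightarrow> nat) \<Rightarrow> 'a::real_normed_field) \<Rightarrow> 'a^'n \<Rightarrow> 'n \<Rightarrow> 'a" where
  "hom_rhs M c z n = (\<Sum>m\<in>multi_indices M. c n m * (\<Prod>i\<in>UNIV. (z $ i) ^ m i))"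

definition solves_ivp_on ::
  "nat \<Rightarrow> ('n::finite \<Rightarrow> ('n \<Rightarrow> nat) \<Rightarrow> 'a::real_normed_field) \<Rightarrow> real set \<Rightarrow> 'a^'n \<Rightarrow>
    (real \<Rightarrow> 'a^'n) \<Rightarrow> bool" where
  "solves_ivp_on M c S z0 z \<longleftrightarrow> z 0 = z0 \<and>
     (\<forall>t\<in>S. \<forall>n. ((\<lambda>s. z s $ n) has_vector_derivative hom_rhs M c (z t) n) (at t within S))"

definition solves_ivp_complex_time_on ::
  "nat \<Rightarrow> ('n::finite \<Rightarrow> ('n \<Rightarrow> nat) \<Rightarrow> complex) \<Rightarrow> complex set \<Rightarrow> complex^'n \<Rightarrow>
    (complex \<Rightarrow> complex^'n) \<Rightarrow> bool" where
  "solves_ivp_complex_time_on M c S z0 z \<longleftrightarrow> z 0 = z0 \<and>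
     (\<forall>t\<in>S. \<forall>n. ((\<lambda>s. z s $ n) has_field_derivative hom_rhs M c (z t) n) (at t within S))"

text \<open>For \<open>'a = complex\<close>, \<open>powr\<close> is the principal branch, the one with value \<open>1\<close> at \<open>t = 0\<close>.\<close>

definition special_solution ::
  "nat \<Rightarrow> 'a \<Rightarrow> 'a^'n \<Rightarrow> 'a \<Rightarrow> 'a::{ln,real_normed_field}^'n::finite" where
  "special_solution M K z0 t = (\<chi> n. z0 $ n * (1 + K * t) powr (1 / (1 - of_nat M)))"

end

theory Submission
  imports Defs
begin

text \<open>
  The proof separates variables. Because the right-hand side is homogeneous of degree \<open>M\<close>, the
  ansatz \<open>z(t) = w(t) z(0)\<close> with a scalar profile \<open>w\<close> turns the system into
  \<open>w'(t) z\<^sub>n(0) = w(t)^M F\<^sub>n(z(0))\<close>, where \<open>F\<close> is the right-hand side. The algebraic constraints say that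
  \<open>(1 - M) F(z(0)) = K z(0)\<close>, so all \<open>N\<close> equations follow from the single scalar equation
  \<open>w' = K / (1 - M) w^M\<close>; this is \<open>hom_rhs_ray\<close>.

  The profile \<open>w(t) = (1 + K t)^a\<close> with \<open>a = 1 / (1 - M)\<close> solves this equation because its
  derivative is \<open>a K (1 + K t)^(a - 1)\<close> and \<open>a - 1 = M a\<close> (\<open>powr_profile_power\<close>).

  The one delicate point is a complex-valued solution in real time: if \<open>K\<close> is real and negative,
  then after the singular time \<open>- 1 / K\<close> the path \<open>1 + K t\<close> lies on the negative axis, where the
  principal branch is discontinuous. However, the path stays on that axis, and there the principal power is a
  constant times a power of \<open>- (1 + K t)\<close>, which is differentiable along the path. If \<open>K\<close> is not
  real, the path never meets the branch cut (\<open>has_vector_derivative_powr_line\<close>).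
\<close>

lemma hom_rhs_scale:
  "hom_rhs M c (\<chi> i. z $ i * v) n = v ^ M * hom_rhs M c z n"
proof -
  have "c n m * (\<Prod>i\<in>UNIV. (z $ i * v) ^ m i) = v ^ M * (c n m * (\<Prod>i\<in>UNIV. (z $ i) ^ m i))"
    if "m \<in> multi_indices M" for m
  proof -
    have "(\<Prod>i\<in>UNIV. v ^ m i) = v ^ M"
      using that by (simp add: multi_indices_def flip: power_sum)
    then show ?thesis
      by (simp add: power_mult_distrib prod.distrib)
  qed
  then show ?thesis
    unfolding hom_rhs_def sum_distrib_left vec_lambda_beta by (intro sum.cong refl)
qed

lemma one_minus_of_nat_nonzero:
  assumes "M \<ge> 2"
  shows "(1 - of_nat M :: 'a::ring_char_0) \<noteq> 0"
  using assms by (metis One_nat_def eq_iff_diff_eq_0 not_less_eq_eq numeral_2_eq_2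
      of_nat_1_eq_iff order_refl)

lemma hom_rhs_ray:
  fixes K :: "'a::real_normed_field"
  assumes "M \<ge> 2" and "K * z $ n = (1 - of_nat M) * hom_rhs M c z n"
  shows "z $ n * (K / (1 - of_nat M) * v ^ M) = hom_rhs M c (\<chi> i. z $ i * v) n"
proof -
  have "(1 - of_nat M :: 'a) \<noteq> 0"
    using assms(1) by (rule one_minus_of_nat_nonzero)
  then have "K * z $ n / (1 - of_nat M) = hom_rhs M c z n"
    using assms(2) by simp
  then show ?thesis
    unfolding hom_rhs_scale by (metis mult.assoc mult.commute times_divide_eq_left)
qed

lemma powr_profile_power:
  fixes x :: "'a::{ln, real_normed_field, banach}"
  assumes "M \<ge> 2" and "x \<noteq> 0"
  shows "x powr (1 / (1 - of_nat M) - 1) = (x powr (1 / (1 - of_nat M))) ^ M"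
proof -
  have "(1 - of_nat M :: 'a) \<noteq> 0"
    using assms(1) by (rule one_minus_of_nat_nonzero)
  then have "1 / (1 - of_nat M) - 1 = of_nat M * (1 / (1 - of_nat M) :: 'a)"
    by (simp add: field_simps)
  then show ?thesis
    using assms(2) by (simp only: powr_def exp_of_nat_mult mult.assoc if_False)
qed

text \<open>
  On the negative real axis the principal logarithm is \<open>Ln (- x) + \<i> \<pi>\<close>, so that restricted to
  this axis the principal power is differentiable although it jumps across it.
\<close>

lemma powr_neg_real:
  fixes a :: complex
  assumes "x < 0"
  shows "of_real x powr a = exp (a * (\<i> * of_real pi)) * (- of_real x) powr a"
proof -
  have "Ln (of_real x) = Ln (- of_real x) + \<i> * of_real pi"
    using Ln_minus[of "- of_real x"] assms by simp
  then show ?thesis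
    using assms by (simp add: powr_def exp_add algebra_simps)
qed

lemma has_vector_derivative_powr_line:
  fixes K a :: complex and t :: real
  assumes nz: "1 + K * of_real t \<noteq> 0"
  shows "((\<lambda>s. (1 + K * of_real s) powr a) has_vector_derivative
           K * a * (1 + K * of_real t) powr (a - 1)) (at t within S)"
proof (cases "1 + K * of_real t \<in> \<real>\<^sub>\<le>\<^sub>0")
  case False
  have "((\<lambda>z. (1 + K * z) powr a) has_field_derivative
          K * a * (1 + K * of_real t) powr (a - 1)) (at (of_real t))"
    using False by (auto intro!: derivative_eq_intros simp: mult_ac)
  then show ?thesis
    by (rule has_vector_derivative_real_field)
next
  case True
  have "t \<noteq> 0"
    using True by auto
  moreover have "Im K * t = 0"
    using True by (auto simp: complex_nonpos_Reals_iff)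
  ultimately obtain k where k: "K = of_real k"
    by (metis complex_is_Real_iff Reals_cases mult_eq_0_iff)
  have neg: "1 + k * t < 0"
  proof -
    have "1 + k * t \<le> 0"
      using True by (simp add: k complex_nonpos_Reals_iff)
    moreover have "1 + k * t \<noteq> 0"
      using nz unfolding k by (metis of_real_0 of_real_1 of_real_add of_real_mult)
    ultimately show ?thesis by simp
  qed
  let ?e = "exp (a * (\<i> * of_real pi))"
  have notin: "- (1 + K * of_real t) \<notin> \<real>\<^sub>\<le>\<^sub>0"
    using neg by (simp add: k complex_nonpos_Reals_iff)
  have "((\<lambda>z. ?e * (- (1 + K * z)) powr a) has_field_derivative
          ?e * (- K * a * (- (1 + K * of_real t)) powr (a - 1))) (at (of_real t))"
    using notin by (auto intro!: derivative_eq_intros simp: mult_ac)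
  then have "((\<lambda>s. ?e * (- (1 + K * of_real s)) powr a) has_vector_derivative
          ?e * (- K * a * (- (1 + K * of_real t)) powr (a - 1))) (at t)"
    by (rule has_vector_derivative_real_field)
  moreover have "?e * (- K * a * (- (1 + K * of_real t)) powr (a - 1)) =
      K * a * (1 + K * of_real t) powr (a - 1)"
  proof -
    \<comment> \<open>Lowering the exponent by \<open>1\<close> contributes the factor \<open>exp (- \<i> \<pi>) = - 1\<close>, which cancels
      the sign of the inner derivative.\<close>
    have "exp ((a - 1) * (\<i> * of_real pi)) = - ?e"
      by (simp add: left_diff_distrib exp_diff)
    then show ?thesis
      using powr_neg_real[OF neg, of "a - 1"] by (simp add: k)
  qed
  ultimately have deriv: "((\<lambda>s. ?e * (- (1 + K * of_real s)) powr a) has_vector_derivative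
      K * a * (1 + K * of_real t) powr (a - 1)) (at t)"
    by simp
  have "open {s. 1 + k * s < 0}"
    by (intro open_Collect_less continuous_intros)
  then have near: "eventually (\<lambda>s. 1 + k * s < 0) (at t)"
    using neg by (auto simp: eventually_at_topological)
  have eq: "?e * (- (1 + K * of_real s)) powr a = (1 + K * of_real s) powr a"
    if "1 + k * s < 0" for s
    using powr_neg_real[OF that, of a] by (simp add: k)
  have "((\<lambda>s. (1 + K * of_real s) powr a) has_vector_derivative
      K * a * (1 + K * of_real t) powr (a - 1)) (at t)"
    using deriv unfolding has_vector_derivative_def
    by (rule has_derivative_transform_eventually)
      (use neg eq in \<open>auto intro: eventually_mono[OF near]\<close>)
  then show ?thesis
    by (rule has_vector_derivative_at_within)
qed

lemma special_solution_0:
  fixes z0 :: "'a::{ln, real_normed_field, banach}^'n::finite"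
  assumes "ln (1 :: 'a) = 0"
  shows "special_solution M K z0 0 = z0"
  using assms by (simp add: special_solution_def powr_def vec_eq_iff)

theorem mainTheorem1:
  fixes M :: nat
  assumes "CARD('n::finite) \<ge> 2" and "M \<ge> 2"
  shows
    "(\<forall>(c :: 'n \<Rightarrow> ('n \<Rightarrow> nat) \<Rightarrow> real) (K :: real) (z0 :: real^'n).
        (\<forall>n. K * z0 $ n = (1 - of_nat M) * hom_rhs M c z0 n) \<longrightarrow>
          solves_ivp_on M c {t. 0 \<le> t \<and> 1 + K * t > 0} z0 (special_solution M K z0))
     \<and>
     (\<forall>(c :: 'n \<Rightarrow> ('n \<Rightarrow> nat) \<Rightarrow> complex) (K :: complex) (z0 :: complex^'n).
        (\<forall>n. K * z0 $ n = (1 - of_nat M) * hom_rhs M c z0 n) \<longrightarrow>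
          solves_ivp_on M c {t. 0 \<le> t \<and> 1 + K * of_real t \<noteq> 0} z0
            (\<lambda>t. special_solution M K z0 (of_real t)) \<and>
          solves_ivp_complex_time_on M c {t. 1 + K * t \<notin> \<real>\<^sub>\<le>\<^sub>0} z0 (special_solution M K z0))"
proof (intro conjI allI impI)
  fix c :: "'n \<Rightarrow> ('n \<Rightarrow> nat) \<Rightarrow> real" and K :: real and z0 :: "real^'n"
  assume H: "\<forall>n. K * z0 $ n = (1 - of_nat M) * hom_rhs M c z0 n"
  let ?a = "1 / (1 - of_nat M) :: real"
  have "((\<lambda>s. special_solution M K z0 s $ n) has_vector_derivative
           hom_rhs M c (special_solution M K z0 t) n) (at t within S)"
    if "1 + K * t > 0" for t n S
  proof -
    have "((\<lambda>s. (1 + K * s) powr ?a) has_real_derivative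
            K * ?a * (1 + K * t) powr (?a - 1)) (at t within S)"
      using that by (auto intro!: derivative_eq_intros simp: powr_diff)
    then have "((\<lambda>s. (1 + K * s) powr ?a) has_vector_derivative
            K / (1 - of_nat M) * ((1 + K * t) powr ?a) ^ M) (at t within S)"
      using that powr_profile_power[OF assms(2), of "1 + K * t"]
      by (simp add: has_real_derivative_iff_has_vector_derivative)
    from has_vector_derivative_mult_right[OF this, of "z0 $ n"] show ?thesis
      by (simp only: special_solution_def vec_lambda_beta hom_rhs_ray[OF assms(2) H[rule_format]])
  qed
  then show "solves_ivp_on M c {t. 0 \<le> t \<and> 1 + K * t > 0} z0 (special_solution M K z0)"
    by (simp add: solves_ivp_on_def special_solution_0)
next
  fix c :: "'n \<Rightarrow> ('n \<Rightarrow> nat) \<Rightarrow> complex" and K :: complex and z0 :: "complex^'n"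
  assume H: "\<forall>n. K * z0 $ n = (1 - of_nat M) * hom_rhs M c z0 n"
  let ?a = "1 / (1 - of_nat M) :: complex"
  have "((\<lambda>s. special_solution M K z0 (of_real s) $ n) has_vector_derivative
           hom_rhs M c (special_solution M K z0 (of_real t)) n) (at t within S)"
    if "1 + K * of_real t \<noteq> 0" for t n S
  proof -
    have "((\<lambda>s. (1 + K * of_real s) powr ?a) has_vector_derivative
            K / (1 - of_nat M) * ((1 + K * of_real t) powr ?a) ^ M) (at t within S)"
      using has_vector_derivative_powr_line[OF that, of ?a]
        powr_profile_power[OF assms(2) that] by simp
    from has_vector_derivative_mult_right[OF this, of "z0 $ n"] show ?thesis
      by (simp only: special_solution_def vec_lambda_beta hom_rhs_ray[OF assms(2) H[rule_format]])
  qed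
  then show "solves_ivp_on M c {t. 0 \<le> t \<and> 1 + K * of_real t \<noteq> 0} z0
      (\<lambda>t. special_solution M K z0 (of_real t))"
    by (simp add: solves_ivp_on_def special_solution_0)
next
  fix c :: "'n \<Rightarrow> ('n \<Rightarrow> nat) \<Rightarrow> complex" and K :: complex and z0 :: "complex^'n"
  assume H: "\<forall>n. K * z0 $ n = (1 - of_nat M) * hom_rhs M c z0 n"
  let ?a = "1 / (1 - of_nat M) :: complex"
  have "((\<lambda>s. special_solution M K z0 s $ n) has_field_derivative
           hom_rhs M c (special_solution M K z0 t) n) (at t within S)"
    if "1 + K * t \<notin> \<real>\<^sub>\<le>\<^sub>0" for t n S
  proof -
    have nz: "1 + K * t \<noteq> 0"
      using that by auto
    have "((\<lambda>s. (1 + K * s) powr ?a) has_field_derivative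
            K * ?a * (1 + K * t) powr (?a - 1)) (at t within S)"
      using that by (auto intro!: derivative_eq_intros simp: mult_ac)
    then have "((\<lambda>s. (1 + K * s) powr ?a) has_field_derivative
            K / (1 - of_nat M) * ((1 + K * t) powr ?a) ^ M) (at t within S)"
      using powr_profile_power[OF assms(2) nz] by simp
    from DERIV_cmult[OF this, of "z0 $ n"] show ?thesis
      by (simp only: special_solution_def vec_lambda_beta hom_rhs_ray[OF assms(2) H[rule_format]])
  qed
  then show "solves_ivp_complex_time_on M c {t. 1 + K * t \<notin> \<real>\<^sub>\<le>\<^sub>0} z0 (special_solution M K z0)"
    by (simp add: solves_ivp_complex_time_on_def special_solution_0)
qed

end
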